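(* Let $\mathcal{F}$ be a union-closed family of finite sets with $\emptyset\in\mathcal{F}$, let $U\subseteq\bigcup\mathcal{F}$, and let $D$ be a finite set with $D\supseteq\bigcup\mathcal{F}$. There exists an extension $\mathcal{F}'=\mathcal{F}\vee\mathcal{H}$ of $(\mathcal{F},U)$ such that (i) $\mathcal{H}$ is a nonempty order filter (up-set) of $2^{D\setminus U}$; (ii) $\mathcal{F}'_{\setminus U}=\mathcal{H}$; (iii) $\mathcal{F}'$ minimizes $\mu$ in $D$; (iv) $\mathcal{F}'_{\setminus N^2}=\{D\setminus N^2\}$.
   Context: For families $\mathcal{A},\mathcal{B}$ of sets, $\mathcal{A}\vee\mathcal{B}=\{A\cup B:A\in\mathcal{A},B\in\mathcal{B}\}$, and $\mathcal{A}_{\setminus Z}=\{A\setminus Z:A\in\mathcal{A}\}$. $J(\mathcal{F})$ is the set of union generators of $\mathcal{F}$ (nonempty $V\in\mathcal{F}$ not equal to the union of the members of $\mathcal{F}$ properly contained in $V$). For a set $X$, $N_{\mathcal{F}}(X)=X\cup\bigcup\{V\in J(\mathcal{F}):V\cap X\neq\emptyset\}$; $N=N_{\mathcal{F}}(U)$ and $N^2=N_{\mathcal{F}}(N)$. $\pi_{\mathcal{F}}(X)=\bigcup\{V\in\mathcal{F}:V\subseteq X\}$. A union-closed family $\mathcal{F}'$ is an extension of $(\mathcal{F},U)$ if $\mathcal{F}'=\mathcal{F}\vee\mathcal{H}$ for a nonempty union-closed family $\mathcal{H}$ with $(\bigcup\mathcal{H})\cap U=\emptyset$. For $X$ with $X\cap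 U=\emptyset$, $E(X)$ is the set of $Y\subseteq U$ with $\pi_{\mathcal{F}}(X\cup Y)\cap U=Y$ and $\pi_{\mathcal{F}}(X\cup Y)\supseteq\pi_{\mathcal{F}}(X\cup U)\setminus U$. For an extension $\mathcal{F}'$, $\mu_{\mathcal{F}'}=\sum_{X\in\mathcal{F}'_{\setminus U}}|E(X)|\,/\,|\mathcal{F}'_{\setminus U}|$. An extension $\mathcal{F}'$ minimizes $\mu$ in $D$ if $\bigcup\mathcal{F}'\subseteq D$ and $\mu_{\mathcal{F}'}\le\mu_{\mathcal{F}''}$ for every extension $\mathcal{F}''$ of $(\mathcal{F},U)$ with $\bigcup\mathcal{F}''\subseteq D$. *)

theory Defs
  imports Complex_Main
begin

definition union_closed :: "'a set set \<Rightarrow> bool" where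
  "union_closed F \<longleftrightarrow> (\<forall>A\<in>F. \<forall>B\<in>F. A \<union> B \<in> F)"

definition family_join :: "'a set set \<Rightarrow> 'a set set \<Rightarrow> 'a set set" where
  "family_join F G = {A \<union> B | A B. A \<in> F \<and> B \<in> G}"

definition family_minus :: "'a set set \<Rightarrow> 'a set \<Rightarrow> 'a set set" where
  "family_minus F Z = {A - Z | A. A \<in> F}"

definition union_generators :: "'a set set \<Rightarrow> 'a set set" where
  "union_generators F = {V \<in> F. V \<noteq> {} \<and> V \<noteq> \<Union>{W \<in> F. W \<subset> V}}"

definition nbhd :: "'a set set \<Rightarrow> 'a set \<Rightarrow> 'a set" where
  "nbhd F X = X \<union> \<Union>{V \<in> union_generators F. V \<inter> X \<noteq> {}}"

definition proj :: "'a set set \<Rightarrow> 'a set \<Rightarrow> 'a set" where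
  "proj F X = \<Union>{V \<in> F. V \<subseteq> X}"

definition extension_by :: "'a set set \<Rightarrow> 'a set \<Rightarrow> 'a set set \<Rightarrow> 'a set set \<Rightarrow> bool" where
  "extension_by F U H F' \<longleftrightarrow>
     union_closed F' \<and> H \<noteq> {} \<and> union_closed H \<and> \<Union>H \<inter> U = {} \<and> F' = family_join F H"

definition extension :: "'a set set \<Rightarrow> 'a set \<Rightarrow> 'a set set \<Rightarrow> bool" where
  "extension F U F' \<longleftrightarrow> (\<exists>H. extension_by F U H F')"

text \<open>Meant for \<open>X\<close> disjoint from \<open>U\<close>.\<close>

definition E_set :: "'a set set \<Rightarrow> 'a set \<Rightarrow> 'a set \<Rightarrow> 'a set set" where
  "E_set F U X =
     {Y. Y \<subseteq> U \<and> proj F (X \<union> Y) \<inter> U = Y \<and> proj F (X \<union> U) - U \<subseteq> proj F (X \<union> Y)}"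

text \<open>Meant for extensions \<open>F'\<close> of \<open>(F, U)\<close> with \<open>\<Union>F'\<close> finite, so that the sum and both
  cardinalities are those of finite sets and the denominator is nonzero.\<close>

definition mu :: "'a set set \<Rightarrow> 'a set \<Rightarrow> 'a set set \<Rightarrow> real" where
  "mu F U F' =
     (\<Sum>X\<in>family_minus F' U. real (card (E_set F U X))) / real (card (family_minus F' U))"

definition minimizes_mu :: "'a set set \<Rightarrow> 'a set \<Rightarrow> 'a set \<Rightarrow> 'a set set \<Rightarrow> bool" where
  "minimizes_mu F U D F' \<longleftrightarrow>
     extension F U F' \<and> \<Union>F' \<subseteq> D \<and>
     (\<forall>F''. extension F U F'' \<and> \<Union>F'' \<subseteq> D \<longrightarrow> mu F U F' \<le> mu F U F'')"

text \<open>Up-set of the power set of \<open>S\<close>; in contrast to filters in the sense of lattice theory,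
  closure under intersections is not required.\<close>

definition order_filter_of_Pow :: "'a set \<Rightarrow> 'a set set \<Rightarrow> bool" where
  "order_filter_of_Pow S H \<longleftrightarrow> H \<subseteq> Pow S \<and> (\<forall>A\<in>H. \<forall>B. A \<subseteq> B \<and> B \<subseteq> S \<longrightarrow> B \<in> H)"

end

theory Submission
  imports Defs
begin

text \<open>
  Writing \<open>G = F'\<^sub>\<setminus>\<^sub>U\<close>, the value \<open>\<mu>\<close> is the mean of \<open>|E(X)|\<close> over \<open>G\<close>, and \<open>G\<close> absorbs unions with
  \<open>V - U\<close> for \<open>V \<in> F\<close>. Reimer's up-compression maps the union-closed family \<open>G\<close> injectively onto an
  up-set by some \<open>\<phi>\<close> with \<open>A \<subseteq> \<phi> A\<close> such that \<open>\<phi> A\<close> contains no member of \<open>G\<close> that is not already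
  contained in \<open>A\<close>. Hence no member of \<open>F\<close> is gained when \<open>A\<close> is replaced by \<open>\<phi> A\<close>, so
  \<open>E (\<phi> A) = E A\<close> and the mean is unchanged. Since \<open>E X\<close> depends only on \<open>X \<inter> N\<^sup>2\<close>, one may finally pass
  to the fibre of \<open>X \<mapsto> X - N\<^sup>2\<close> with the smallest mean and replace the part of its members outside
  \<open>N\<^sup>2\<close> by \<open>D - N\<^sup>2\<close>.
\<close>

section \<open>Up-compression of union-closed families\<close>

definition up_shift :: "'a \<Rightarrow> 'a set set \<Rightarrow> 'a set \<Rightarrow> 'a set" where
  "up_shift i G A = (if insert i A \<in> G then A else insert i A)"

lemma subset_up_shift: "A \<subseteq> up_shift i G A"
  by (auto simp: up_shift_def)

text \<open>A set moves only onto a set outside \<open>G\<close>, so it cannot collide with an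
  unmoved member; two moved sets both lacked \<open>i\<close>, so removing it recovers them.\<close>

lemma inj_on_up_shift: "inj_on (up_shift i G) G"
proof (rule inj_onI)
  fix A B
  assume "A \<in> G" "B \<in> G" "up_shift i G A = up_shift i G B"
  then show "A = B"
    unfolding up_shift_def
    by (cases "insert i A \<in> G"; cases "insert i B \<in> G"; cases "i \<in> A"; cases "i \<in> B")
      (auto simp: insert_absorb insert_ident)
qed

lemma union_closed_up_shift:
  assumes "union_closed G"
  shows "union_closed (up_shift i G ` G)"
proof -
  \<comment> \<open>The second part may range over all of \<open>G\<close>: if
    \<open>insert i A\<close> is already in \<open>G\<close>, it is itself an unmoved
    member.\<close>
  have eq: "up_shift i G ` G = {A \<in> G. insert i A \<in> G} \<union> insert i ` G"
    unfolding up_shift_def by (auto simp: image_iff)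
  show ?thesis
    unfolding union_closed_def eq
  proof (intro ballI)
    fix A B
    assume A: "A \<in> {A \<in> G. insert i A \<in> G} \<union> insert i ` G"
      and B: "B \<in> {A \<in> G. insert i A \<in> G} \<union> insert i ` G"
    have cl: "\<And>A B. A \<in> G \<Longrightarrow> B \<in> G \<Longrightarrow> A \<union> B \<in> G"
      using assms unfolding union_closed_def by blast
    obtain A' where A': "A' \<in> G" "A = A' \<and> insert i A' \<in> G \<or> A = insert i A'"
      using A by blast
    obtain B' where B': "B' \<in> G" "B = B' \<and> insert i B' \<in> G \<or> B = insert i B'"
      using B by blast
    \<comment> \<open>If both sets are unmoved, \<open>insert i A' \<union> B'\<close> in
      \<open>G\<close> keeps the union unmoved; otherwise the union contains
      \<open>i\<close>.\<close>
    have "A \<union> B = A' \<union> B' \<and> insert i (A' \<union> B') \<in> G \<or> A \<union> B = insert i (A' \<union> B')"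
      using A'(2) B'(2) cl[OF _ B'(1), of "insert i A'"] by auto
    then show "A \<union> B \<in> {A \<in> G. insert i A \<in> G} \<union> insert i ` G"
      using cl[OF A'(1) B'(1)] by (elim disjE) simp_all
  qed
qed

text \<open>If \<open>A\<close> moves and \<open>B\<close> uses the new point \<open>i\<close>, then
  \<open>A \<union> B = insert i A\<close> lies in \<open>G\<close>, contradicting that
  \<open>A\<close> moves.\<close>

lemma subset_of_subset_up_shift:
  assumes "union_closed G" "A \<in> G" "B \<in> G" "B \<subseteq> up_shift i G A"
  shows "B \<subseteq> A"
proof (cases "insert i A \<in> G")
  case True
  then show ?thesis using assms(4) by (simp add: up_shift_def)
next
  case False
  have "A \<union> B \<in> G" using assms unfolding union_closed_def by blast
  moreover have "i \<in> B \<Longrightarrow> A \<union> B = insert i A"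
    using assms(4) False by (auto simp: up_shift_def)
  ultimately show ?thesis using False assms(4) by (auto simp: up_shift_def)
qed

text \<open>Shifts are iterated until none moves a set. Each effective shift lowers the total number
  of missing points, so this stops, and the no-gain condition is carried back through the
  composition.\<close>

lemma up_compression:
  fixes G :: "'a set set"
  assumes "finite S" "G \<subseteq> Pow S" "union_closed G"
  shows "\<exists>\<phi>. inj_on \<phi> G \<and> order_filter_of_Pow S (\<phi> ` G)
           \<and> (\<forall>A\<in>G. A \<subseteq> \<phi> A \<and> (\<forall>B\<in>G. B \<subseteq> \<phi> A \<longrightarrow> B \<subseteq> A))"
  using assms(2,3)
proof (induction "\<Sum>A\<in>G. card (S - A)" arbitrary: G rule: less_induct)
  case less
  have finG: "finite G" using less.prems(1) assms(1) by (meson finite_Pow_iff finite_subset)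
  show ?case
  proof (cases "\<forall>A\<in>G. \<forall>i\<in>S. insert i A \<in> G")
    case True
    have "B \<in> G" if "A \<in> G" "A \<subseteq> B" "B \<subseteq> S" for A B
    proof -
      \<comment> \<open>A family stable under adding single points is an up-set: the points of
        \<open>B\<close> are added one at a time.\<close>
      have "A \<union> C \<in> G" if "finite C" "C \<subseteq> S" for C
        using that
        by (induction C rule: finite_induct) (use \<open>A \<in> G\<close> True in auto)
      from this[of B] that show ?thesis
        using assms(1) finite_subset by (auto simp: sup_absorb2)
    qed
    then have "order_filter_of_Pow S G"
      using less.prems(1) unfolding order_filter_of_Pow_def by blast
    then show ?thesis by (intro exI[of _ "\<lambda>A. A"]) auto
  next
    case False
    then obtain A0 i where A0: "A0 \<in> G" "i \<in> S" "insert i A0 \<notin> G" by blast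
    define g where "g = up_shift i G"
    have inj: "inj_on g G" unfolding g_def by (rule inj_on_up_shift)
    have sub: "A \<subseteq> g A" for A unfolding g_def by (rule subset_up_shift)
    have "(\<Sum>A\<in>G. card (S - g A)) < (\<Sum>A\<in>G. card (S - A))"
    proof (rule sum_strict_mono_ex1[OF finG])
      show "\<forall>A\<in>G. card (S - g A) \<le> card (S - A)"
        using sub assms(1) by (meson Diff_mono card_mono finite_Diff order_refl)
      have "i \<notin> A0" using A0 by (metis insert_absorb)
      then have "S - g A0 \<subset> S - A0" using A0 unfolding g_def up_shift_def by auto
      then show "\<exists>A\<in>G. card (S - g A) < card (S - A)"
        using A0(1) assms(1) by (meson finite_Diff psubset_card_mono)
    qed
    then have smaller: "(\<Sum>A\<in>g ` G. card (S - A)) < (\<Sum>A\<in>G. card (S - A))"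
      using inj by (simp add: sum.reindex)
    have subS: "g ` G \<subseteq> Pow S" using less.prems(1) A0(2) unfolding g_def up_shift_def by auto
    have uc: "union_closed (g ` G)"
      unfolding g_def by (rule union_closed_up_shift[OF less.prems(2)])
    obtain \<psi> where \<psi>: "inj_on \<psi> (g ` G)" "order_filter_of_Pow S (\<psi> ` g ` G)"
      "\<And>A. A \<in> G \<Longrightarrow> g A \<subseteq> \<psi> (g A)"
      "\<And>A B. A \<in> G \<Longrightarrow> B \<in> G \<Longrightarrow> g B \<subseteq> \<psi> (g A) \<Longrightarrow> g B \<subseteq> g A"
      using less.hyps[OF smaller subS uc] by (auto simp only: ball_simps)
    \<comment> \<open>The induction hypothesis speaks of \<open>g B\<close>, which may stick out of
      \<open>\<psi> (g A)\<close> although \<open>B\<close> does not. Then \<open>i\<close> is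
      missing there, so \<open>A\<close> is unmoved with \<open>insert i A\<close> in
      \<open>G\<close>. Hence \<open>g\<close> also fixes \<open>A \<union> B\<close>, to which the
      hypothesis applies instead.\<close>
    have "B \<subseteq> A" if A: "A \<in> G" and B: "B \<in> G" and BA: "B \<subseteq> \<psi> (g A)" for A B
    proof (cases "g B \<subseteq> \<psi> (g A)")
      case True
      then have "B \<subseteq> g A" using \<psi>(4)[OF A B] sub by blast
      then show ?thesis
        using subset_of_subset_up_shift[OF less.prems(2) A B] unfolding g_def by blast
    next
      case False
      then have i: "i \<notin> \<psi> (g A)" using BA unfolding g_def up_shift_def by (auto split: if_splits)
      then have "i \<notin> g A" using \<psi>(3)[OF A] by blast
      then have gA: "g A = A" "insert i A \<in> G"
        unfolding g_def up_shift_def by (auto split: if_splits)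
      have AB: "insert i A \<union> B \<in> G" "A \<union> B \<in> G"
        using less.prems(2) gA A B unfolding union_closed_def by blast+
      then have "g (A \<union> B) = A \<union> B" unfolding g_def up_shift_def by simp
      moreover have "A \<union> B \<subseteq> \<psi> (g A)" using BA \<psi>(3)[OF A] gA by auto
      ultimately show ?thesis using \<psi>(4)[OF A AB(2)] gA by auto
    qed
    moreover have "A \<subseteq> \<psi> (g A)" if "A \<in> G" for A using sub \<psi>(3)[OF that] by blast
    ultimately show ?thesis
      using inj \<psi>(1,2) by (intro exI[of _ "\<psi> \<circ> g"]) (auto simp: comp_inj_on image_comp)
  qed
qed

section \<open>Generators and locality of \<open>E_set\<close>\<close>

lemma in_union_generator:
  assumes "finite V" "V \<in> F" "x \<in> V"
  shows "\<exists>W\<in>union_generators F. W \<subseteq> V \<and> x \<in> W"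
  using assms
proof (induction V rule: finite_psubset_induct)
  case (psubset V)
  show ?case
  proof (cases "V \<in> union_generators F")
    case True
    then show ?thesis using psubset.prems by blast
  next
    case False
    then have "V = \<Union>{W \<in> F. W \<subset> V}"
      using psubset.prems unfolding union_generators_def by blast
    then obtain W where "W \<in> F" "W \<subset> V" "x \<in> W" using psubset.prems by blast
    then obtain W' where "W' \<in> union_generators F" "W' \<subseteq> W" "x \<in> W'"
      using psubset.IH[of W] by blast
    then show ?thesis using \<open>W \<subset> V\<close> by blast
  qed
qed

lemma in_proj_generator:
  assumes "\<forall>A\<in>F. finite A" "x \<in> proj F X"
  obtains W where "W \<in> union_generators F" "W \<subseteq> X" "x \<in> W"
proof -
  obtain V where "V \<in> F" "V \<subseteq> X" "x \<in> V" using assms(2) unfolding proj_def by blast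
  then obtain W where "W \<in> union_generators F" "W \<subseteq> V" "x \<in> W"
    using in_union_generator[of V F x] assms(1) by blast
  then show thesis using that \<open>V \<subseteq> X\<close> by blast
qed

lemma proj_generator: "W \<in> union_generators F \<Longrightarrow> W \<subseteq> X \<Longrightarrow> W \<subseteq> proj F X"
  unfolding union_generators_def proj_def by blast

lemma subset_nbhd: "X \<subseteq> nbhd F X"
  by (auto simp: nbhd_def)

lemma generator_subset_nbhd:
  "W \<in> union_generators F \<Longrightarrow> x \<in> W \<Longrightarrow> x \<in> X \<Longrightarrow> W \<subseteq> nbhd F X"
  unfolding nbhd_def by blast

text \<open>A generator through a point of \<open>M\<close> lies in \<open>nbhd F M\<close>, so only
  the part of \<open>Z\<close> in that neighbourhood matters.\<close>

lemma in_proj_local: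
  assumes "\<forall>A\<in>F. finite A" "x \<in> proj F Z" "x \<in> M" "Z \<inter> nbhd F M \<subseteq> Z'"
  shows "x \<in> proj F Z'"
proof -
  obtain W where W: "W \<in> union_generators F" "W \<subseteq> Z" "x \<in> W"
    using in_proj_generator[OF assms(1,2)] .
  then have "W \<subseteq> Z'" using generator_subset_nbhd[OF W(1,3) assms(3)] assms(4) by blast
  then show ?thesis using W proj_generator by blast
qed

text \<open>On \<open>nbhd F U\<close> the projections depend only on the second neighbourhood. A
  point elsewhere is covered only by generators missing \<open>U\<close>, which are available for
  every \<open>Y\<close>.\<close>

lemma E_set_local_subset:
  assumes fin: "\<forall>A\<in>F. finite A"
    and eq: "X \<inter> nbhd F (nbhd F U) = X' \<inter> nbhd F (nbhd F U)"
  shows "E_set F U X \<subseteq> E_set F U X'"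
proof
  fix Y
  assume "Y \<in> E_set F U X"
  then have Y: "Y \<subseteq> U" "proj F (X \<union> Y) \<inter> U = Y" "proj F (X \<union> U) - U \<subseteq> proj F (X \<union> Y)"
    unfolding E_set_def by auto
  let ?N = "nbhd F U"
  have transfer: "x \<in> proj F (X \<union> Z) \<longleftrightarrow> x \<in> proj F (X' \<union> Z)" if "x \<in> ?N" for x Z
    using in_proj_local[OF fin _ that] eq by (metis Int_Un_distrib2 inf.cobounded1)
  have "proj F (X' \<union> Y) \<inter> U = Y"
    using transfer Y(2) subset_nbhd[of U F] by blast
  moreover have "x \<in> proj F (X' \<union> Y)" if x: "x \<in> proj F (X' \<union> U)" "x \<notin> U" for x
  proof -
    obtain W where W: "W \<in> union_generators F" "W \<subseteq> X' \<union> U" "x \<in> W"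
      using in_proj_generator[OF fin x(1)] .
    show ?thesis
    proof (cases "W \<inter> U = {}")
      case True
      then show ?thesis using W proj_generator[OF W(1), of "X' \<union> Y"] by blast
    next
      case False
      then have "x \<in> ?N" using W unfolding nbhd_def by blast
      then show ?thesis using transfer x Y(3) by blast
    qed
  qed
  ultimately show "Y \<in> E_set F U X'" using Y(1) unfolding E_set_def by blast
qed

lemma E_set_local:
  assumes "\<forall>A\<in>F. finite A"
    and "X \<inter> nbhd F (nbhd F U) = X' \<inter> nbhd F (nbhd F U)"
  shows "E_set F U X = E_set F U X'"
  using E_set_local_subset[OF assms] E_set_local_subset[OF assms(1) assms(2)[symmetric]] by blast

text \<open>For each \<open>Y \<subseteq> U\<close> the same members of \<open>F\<close> fit into
  \<open>A \<union> Y\<close> and \<open>A' \<union> Y\<close>, so all projections agree.\<close>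

lemma E_set_eq_if_no_gain:
  assumes "A \<subseteq> A'" "A' \<inter> U = {}" "\<And>V. V \<in> F \<Longrightarrow> V - U \<subseteq> A' \<Longrightarrow> V - U \<subseteq> A"
  shows "E_set F U A' = E_set F U A"
proof -
  have "proj F (A' \<union> Y) = proj F (A \<union> Y)" if "Y \<subseteq> U" for Y
  proof -
    have "V \<subseteq> A' \<union> Y \<longleftrightarrow> V \<subseteq> A \<union> Y" if "V \<in> F" for V
      using assms(1,2) assms(3)[OF that] \<open>Y \<subseteq> U\<close> by blast
    then show ?thesis unfolding proj_def by (metis (no_types, lifting))
  qed
  then show ?thesis unfolding E_set_def by auto
qed

section \<open>Averaging over fibres\<close>

lemma exists_fibre_mean_le:
  fixes f :: "'b \<Rightarrow> real"
  assumes "finite H" "H \<noteq> {}"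
  shows "\<exists>s\<in>p ` H. sum f {x \<in> H. p x = s} / card {x \<in> H. p x = s} \<le> sum f H / card H"
proof (rule ccontr)
  assume neg: "\<not> ?thesis"
  let ?K = "\<lambda>s. {x \<in> H. p x = s}"
  let ?m = "sum f H / card H"
  \<comment> \<open>Summed over the fibres, these strict inequalities would make the total exceed
    itself.\<close>
  have "?m * card (?K s) < sum f (?K s)" if "s \<in> p ` H" for s
  proof -
    have "card (?K s) > 0" using that assms(1) by (auto simp: card_gt_0_iff)
    moreover have "?m < sum f (?K s) / card (?K s)" using neg that by (auto simp: not_le)
    ultimately show ?thesis by (simp add: pos_less_divide_eq)
  qed
  then have "(\<Sum>s\<in>p ` H. ?m * card (?K s)) < (\<Sum>s\<in>p ` H. sum f (?K s))"
    using assms by (intro sum_strict_mono) auto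
  also have "(\<Sum>s\<in>p ` H. sum f (?K s)) = sum f H"
    using sum.image_gen[OF assms(1), of f p] by simp
  also have "(\<Sum>s\<in>p ` H. ?m * card (?K s)) = ?m * (\<Sum>s\<in>p ` H. \<Sum>x\<in>?K s. 1)"
    by (simp add: sum_distrib_left)
  also have "(\<Sum>s\<in>p ` H. \<Sum>x\<in>?K s. 1) = real (card H)"
    using sum.image_gen[OF assms(1), of "\<lambda>_. 1 :: real" p] by simp
  finally show False using assms by simp
qed

section \<open>Extensions and their traces outside \<open>U\<close>\<close>

lemma order_filter_extension:
  assumes "union_closed F" "{} \<in> F" "\<Union>F \<subseteq> D" "U \<subseteq> D"
    and "H \<noteq> {}" "order_filter_of_Pow (D - U) H"
  shows "extension_by F U H (family_join F H)"
    and "family_minus (family_join F H) U = H"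
    and "\<Union>(family_join F H) \<subseteq> D"
proof -
  have sub: "\<And>A. A \<in> H \<Longrightarrow> A \<subseteq> D - U"
    and up: "\<And>A B. A \<in> H \<Longrightarrow> A \<subseteq> B \<Longrightarrow> B \<subseteq> D - U \<Longrightarrow> B \<in> H"
    using assms(6) unfolding order_filter_of_Pow_def by auto
  have ucH: "A \<union> B \<in> H" if "A \<in> H" "B \<in> H" for A B
    using up[OF that(1), of "A \<union> B"] sub[OF that(1)] sub[OF that(2)] by auto
  have "union_closed (family_join F H)"
    unfolding union_closed_def
  proof (intro ballI)
    fix A B
    assume "A \<in> family_join F H" "B \<in> family_join F H"
    then obtain V P W Q where "V \<in> F" "P \<in> H" "A = V \<union> P" "W \<in> F" "Q \<in> H" "B = W \<union> Q"
      unfolding family_join_def by blast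
    then have "V \<union> W \<in> F" "P \<union> Q \<in> H" "A \<union> B = (V \<union> W) \<union> (P \<union> Q)"
      using assms(1) ucH unfolding union_closed_def by auto
    then show "A \<union> B \<in> family_join F H" unfolding family_join_def by blast
  qed
  then show "extension_by F U H (family_join F H)"
    using assms(5) ucH sub unfolding extension_by_def union_closed_def by blast
  show "family_minus (family_join F H) U = H"
  proof
    show "family_minus (family_join F H) U \<subseteq> H"
    proof
      fix A
      assume "A \<in> family_minus (family_join F H) U"
      then obtain V P where "V \<in> F" and P: "P \<in> H" and A: "A = (V \<union> P) - U"
        unfolding family_minus_def family_join_def by blast
      then have "V \<subseteq> D" using assms(3) by blast
      \<comment> \<open>\<open>A\<close> lies between \<open>P\<close> and \<open>D - U\<close>, so
        the filter absorbs the contribution of \<open>V\<close>.\<close>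
      then show "A \<in> H" using up[OF P, of A] sub[OF P] A by blast
    qed
    show "H \<subseteq> family_minus (family_join F H) U"
    proof
      fix A
      assume A: "A \<in> H"
      then have "A = ({} \<union> A) - U" using sub by blast
      then show "A \<in> family_minus (family_join F H) U"
        using A assms(2) unfolding family_minus_def family_join_def by blast
    qed
  qed
  show "\<Union>(family_join F H) \<subseteq> D"
    using assms(3) sub unfolding family_join_def by blast
qed

text \<open>Only finitely many families compete, being subsets of \<open>Pow D\<close>, and
  \<open>F\<close> is one of them, as the extension by \<open>{{}}\<close>.\<close>

lemma exists_minimizer:
  assumes "union_closed F" "finite D" "\<Union>F \<subseteq> D"
  shows "\<exists>F0. minimizes_mu F U D F0"
proof -
  let ?X = "{F'. extension F U F' \<and> \<Union>F' \<subseteq> D}"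
  have "?X \<subseteq> Pow (Pow D)" by blast
  then have "finite ?X" using assms(2) finite_subset by blast
  moreover have "extension_by F U {{}} F"
    using assms(1) unfolding extension_by_def union_closed_def family_join_def by auto
  then have "F \<in> ?X" using assms(3) unfolding extension_def by blast
  ultimately have "arg_min_on (mu F U) ?X \<in> ?X" "\<forall>F'\<in>?X. \<not> mu F U F' < mu F U (arg_min_on (mu F U) ?X)"
    using arg_min_if_finite[of ?X "mu F U"] by blast+
  then show ?thesis unfolding minimizes_mu_def not_less by blast
qed

lemma extension_trace:
  assumes "union_closed F" "{} \<in> F" "extension F U F'" "\<Union>F' \<subseteq> D"
  defines "G \<equiv> family_minus F' U"
  shows "G \<noteq> {}" "G \<subseteq> Pow (D - U)" "union_closed G"
    and "\<And>V A. V \<in> F \<Longrightarrow> A \<in> G \<Longrightarrow> A \<union> (V - U) \<in> G"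
proof -
  obtain H where H: "union_closed F'" "H \<noteq> {}" "F' = family_join F H"
    using assms(3) unfolding extension_def extension_by_def by blast
  show "G \<noteq> {}" using H assms(2) unfolding G_def family_minus_def family_join_def by blast
  show "G \<subseteq> Pow (D - U)" using assms(4) unfolding G_def family_minus_def by blast
  have "A \<union> B - U = (A - U) \<union> (B - U)" for A B :: "'a set" by blast
  then show "union_closed G"
    using H(1) unfolding G_def family_minus_def union_closed_def by (smt (verit) mem_Collect_eq)
  fix V A
  assume V: "V \<in> F" and "A \<in> G"
  then obtain W P where "W \<in> F" "P \<in> H" "A = (W \<union> P) - U"
    unfolding G_def H(3) family_minus_def family_join_def by blast
  moreover from this have "A \<union> (V - U) = ((V \<union> W) \<union> P) - U" by blast
  moreover have "V \<union> W \<in> F" using V \<open>W \<in> F\<close> assms(1) unfolding union_closed_def by blast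
  ultimately show "A \<union> (V - U) \<in> G"
    unfolding G_def H(3) family_minus_def family_join_def by blast
qed

section \<open>Construction of the minimizing extension\<close>

theorem theorem3p17:
  fixes F :: "'a set set" and U D :: "'a set"
  assumes "union_closed F" and "\<forall>A\<in>F. finite A" and "{} \<in> F"
    and "U \<subseteq> \<Union>F"
    and "finite D" and "\<Union>F \<subseteq> D"
  shows "\<exists>F' H. extension_by F U H F'
           \<and> (H \<noteq> {} \<and> order_filter_of_Pow (D - U) H)
           \<and> family_minus F' U = H
           \<and> minimizes_mu F U D F'
           \<and> family_minus F' (nbhd F (nbhd F U)) = {D - nbhd F (nbhd F U)}"
proof -
  let ?N = "nbhd F (nbhd F U)"
  let ?e = "\<lambda>X. real (card (E_set F U X))"
  have UD: "U \<subseteq> D" using assms(4,6) by blast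
  have UN: "U \<subseteq> ?N" using subset_nbhd by (meson subset_trans)
  obtain F0 where F0: "minimizes_mu F U D F0" using exists_minimizer[OF assms(1,5,6)] by blast
  then have "extension F U F0" "\<Union>F0 \<subseteq> D" unfolding minimizes_mu_def by auto
  note trace = extension_trace[OF assms(1,3) this]
  define G where "G = family_minus F0 U"
  note G = trace[folded G_def]
  obtain \<phi> where \<phi>: "inj_on \<phi> G" "order_filter_of_Pow (D - U) (\<phi> ` G)"
    "\<And>A. A \<in> G \<Longrightarrow> A \<subseteq> \<phi> A" "\<And>A B. A \<in> G \<Longrightarrow> B \<in> G \<Longrightarrow> B \<subseteq> \<phi> A \<Longrightarrow> B \<subseteq> A"
    using up_compression[OF _ G(2,3)] assms(5) by (meson finite_Diff)
  define H1 where "H1 = \<phi> ` G"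
  have H1_sub: "\<And>A. A \<in> H1 \<Longrightarrow> A \<subseteq> D - U"
    and H1_up: "\<And>A B. A \<in> H1 \<Longrightarrow> A \<subseteq> B \<Longrightarrow> B \<subseteq> D - U \<Longrightarrow> B \<in> H1"
    using \<phi>(2) unfolding H1_def order_filter_of_Pow_def by auto
  have "E_set F U (\<phi> A) = E_set F U A" if A: "A \<in> G" for A
  proof (rule E_set_eq_if_no_gain[OF \<phi>(3)[OF A]])
    show "\<phi> A \<inter> U = {}" using H1_sub A unfolding H1_def by blast
    show "V - U \<subseteq> A" if "V \<in> F" "V - U \<subseteq> \<phi> A" for V
      \<comment> \<open>The no-gain property is applied to \<open>A \<union> (V - U)\<close>, a
        member of \<open>G\<close> inside \<open>\<phi> A\<close>.\<close>
      using \<phi>(4)[OF A G(4)[OF that(1) A]] that(2) \<phi>(3)[OF A] by blast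
  qed
  then have "sum ?e H1 / card H1 = sum ?e G / card G"
    unfolding H1_def using \<phi>(1) by (simp add: sum.reindex card_image)
  then have mean_H1: "sum ?e H1 / card H1 = mu F U F0"
    unfolding mu_def G_def by simp
  have finH1: "finite H1" using H1_sub assms(5) by (meson Diff_subset Pow_iff finite_Pow_iff
        finite_subset subsetI subset_trans)
  have "H1 \<noteq> {}" using G(1) unfolding H1_def by simp
  then obtain S where S: "S \<in> (\<lambda>X. X - ?N) ` H1"
    and mean_S: "sum ?e {X \<in> H1. X - ?N = S} / card {X \<in> H1. X - ?N = S} \<le> mu F U F0"
    using exists_fibre_mean_le[OF finH1, of "\<lambda>X. X - ?N" ?e] mean_H1 by auto
  define K where "K = {X \<in> H1. X - ?N = S}"
  define c where "c = (\<lambda>X. X \<union> (D - ?N))"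
  define H where "H = c ` K"
  \<comment> \<open>\<open>c\<close> forgets only the part outside \<open>?N\<close>, which is the
    constant \<open>S\<close> on the fibre.\<close>
  have "inj_on c K"
  proof (rule inj_onI)
    fix X Y
    assume XY: "X \<in> K" "Y \<in> K" "c X = c Y"
    then have "X \<inter> ?N = Y \<inter> ?N" unfolding c_def by blast
    moreover have "X - ?N = Y - ?N" using XY unfolding K_def by simp
    ultimately show "X = Y" by blast
  qed
  moreover have "E_set F U (c X) = E_set F U X" for X
    by (rule E_set_local[OF assms(2)]) (auto simp: c_def)
  ultimately have mean_H: "sum ?e H / card H \<le> mu F U F0"
    using mean_S unfolding H_def K_def[symmetric] by (simp add: sum.reindex card_image)
  have H_ne: "H \<noteq> {}" using S unfolding H_def K_def by blast
  have filter_H: "order_filter_of_Pow (D - U) H"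
    unfolding order_filter_of_Pow_def
  proof (intro conjI ballI allI impI subsetI)
    fix A
    assume "A \<in> H"
    then show "A \<in> Pow (D - U)" using H1_sub UN unfolding H_def K_def c_def by blast
  next
    fix A B
    assume "A \<in> H" and AB: "A \<subseteq> B \<and> B \<subseteq> D - U"
    then obtain X where X: "X \<in> H1" "X - ?N = S" "A = X \<union> (D - ?N)"
      unfolding H_def K_def c_def by blast
    \<comment> \<open>The preimage of \<open>B\<close> under \<open>c\<close>: outside
      \<open>?N\<close> the fibre value \<open>S\<close> is restored. It still contains
      \<open>X\<close>, so it is in \<open>H1\<close>, and \<open>c\<close> returns \<open>B\<close>
      because \<open>B\<close> already contains \<open>D - ?N\<close>.\<close>
    let ?B = "(B \<inter> ?N) \<union> S"
    have "X \<subseteq> ?B" "?B \<subseteq> D - U" using X AB H1_sub[OF X(1)] by blast+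
    then have "?B \<in> H1" using H1_up[OF X(1)] by blast
    moreover have "?B - ?N = S" using X(2) by blast
    moreover have "B = c ?B" using X AB H1_sub[OF X(1)] unfolding c_def by blast
    ultimately show "B \<in> H" unfolding H_def K_def by blast
  qed
  define F' where "F' = family_join F H"
  note ext = order_filter_extension[OF assms(1,3,6) UD H_ne filter_H, folded F'_def]
  have "mu F U F' \<le> mu F U F0" using mean_H ext(2) unfolding mu_def by simp
  then have min: "minimizes_mu F U D F'"
    using F0 ext(1,3) unfolding minimizes_mu_def extension_def by (meson order_trans)
  \<comment> \<open>The component from \<open>H\<close> already fills \<open>D - ?N\<close>, and
    \<open>A\<close> stays inside \<open>D\<close>.\<close>
  have "A - ?N = D - ?N" if "A \<in> F'" for A
    using that ext(3) unfolding F'_def family_join_def H_def c_def by blast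
  moreover have "F' \<noteq> {}" using H_ne assms(3) unfolding F'_def family_join_def by blast
  ultimately have "family_minus F' ?N = {D - ?N}" unfolding family_minus_def by blast
  then show ?thesis using ext(1,2) H_ne filter_H min by blast
qed

end
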